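(* Let $(A,B)$ be a concave monotone pair in $\mathbb{M}_n$ and let $\Phi:\mathbb{M}_n\to\mathbb{M}_d$ be a unital positive linear map. Then there exist a contraction $K\in\mathbb{M}_d$ and a unitary $U\in\mathbb{M}_d$ such that $$\Phi(B)\Phi(A)=\sqrt{\Phi(AB)}\,K\,\sqrt{\Phi(AB)}\,U.$$
   Context: $\mathbb{M}_n$ is the algebra of $n\times n$ complex matrices. A pair $(A,B)$ of matrices in $\mathbb{M}_n$ is a monotone pair if there exist a positive semidefinite $C\in\mathbb{M}_n$ and two non-negative, non-decreasing functions $f,g$ on $[0,\infty)$ such that $A=f(C)$ and $B=g(C)$ (functional calculus). A monotone pair $(A,B)$ is concave if $A=h(B)$ for some concave function $h:[0,\infty)\to[0,\infty)$. A linear map $\Phi$ is positive if it maps positive semidefinite matrices to positive semidefinite matrices, and unital if $\Phi(I)=I$. A contraction is a matrix of operator norm at most $1$. *)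

theory Defs
  imports "HOL-Analysis.Analysis"
begin

text \<open>Matrices are elements of \<^typ>\<open>complex^'n^'n\<close>, with product \<open>**\<close> and identity
  \<^term>\<open>mat 1\<close>; the operation \<open>*\<close> on this type is entrywise and is not used.\<close>

definition cadjoint :: "complex^'n^'m \<Rightarrow> complex^'m^'n" where
  "cadjoint A = (\<chi> i j. cnj (A $ j $ i))"

definition hermitian :: "complex^'n^'n \<Rightarrow> bool" where
  "hermitian A \<longleftrightarrow> cadjoint A = A"

definition unitary :: "complex^'n^'n \<Rightarrow> bool" where
  "unitary U \<longleftrightarrow> cadjoint U ** U = mat 1 \<and> U ** cadjoint U = mat 1"

text \<open>The sum is the quadratic form $x^* A x$, which is real when \<open>A\<close> is Hermitian.\<close>

definition pos_semidef :: "complex^'n^'n \<Rightarrow> bool" where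
  "pos_semidef A \<longleftrightarrow> hermitian A \<and> (\<forall>x. 0 \<le> Re (\<Sum>i\<in>UNIV. cnj (x $ i) * (A *v x) $ i))"

text \<open>The norm of \<^typ>\<open>complex^'n\<close> is the Euclidean one, so \<^const>\<open>onorm\<close> is the operator norm.
  (The norm of \<^typ>\<open>complex^'n^'n\<close> itself is the Frobenius norm.)\<close>

definition contraction :: "complex^'n^'n \<Rightarrow> bool" where
  "contraction K \<longleftrightarrow> onorm (\<lambda>x. K *v x) \<le> 1"

definition real_diag :: "real^'n \<Rightarrow> complex^'n^'n" where
  "real_diag d = (\<chi> i j. if i = j then complex_of_real (d $ i) else 0)"

text \<open>Functional calculus for Hermitian matrices: if $C = U\,\mathrm{diag}(d)\,U^*$ with \<open>U\<close>
  unitary, then $f(C) = U\,\mathrm{diag}(f(d))\,U^*$. The result does not depend on the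
  chosen diagonalization, see \<open>matrix_fun_diag\<close> below; its value for a matrix \<open>C\<close> that is
  not Hermitian is irrelevant.\<close>

definition matrix_fun :: "(real \<Rightarrow> real) \<Rightarrow> complex^'n^'n \<Rightarrow> complex^'n^'n" where
  "matrix_fun f C = (THE M. \<exists>U d. unitary U \<and> C = U ** real_diag d ** cadjoint U
     \<and> M = U ** real_diag (\<chi> i. f (d $ i)) ** cadjoint U)"

definition matrix_sqrt :: "complex^'n^'n \<Rightarrow> complex^'n^'n" where
  "matrix_sqrt A = matrix_fun sqrt A"

text \<open>Functions on $[0,\infty)$ are total functions on the reals constrained on
  \<^term>\<open>{0::real..}\<close>; only their values there matter, as \<open>C\<close> and \<open>B\<close> are positive
  semidefinite.\<close>

definition monotone_pair :: "complex^'n^'n \<Rightarrow> complex^'n^'n \<Rightarrow> bool" where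
  "monotone_pair A B \<longleftrightarrow> (\<exists>C f g. pos_semidef C
     \<and> f ` {0..} \<subseteq> {0..} \<and> mono_on {0..} f
     \<and> g ` {0..} \<subseteq> {0..} \<and> mono_on {0..} g
     \<and> A = matrix_fun f C \<and> B = matrix_fun g C)"

definition concave_monotone_pair :: "complex^'n^'n \<Rightarrow> complex^'n^'n \<Rightarrow> bool" where
  "concave_monotone_pair A B \<longleftrightarrow> monotone_pair A B
     \<and> (\<exists>h. h ` {0..} \<subseteq> {0..} \<and> concave_on {0..} h \<and> A = matrix_fun h B)"

text \<open>\<^const>\<open>linear\<close> only expresses real linearity, whence the complex scaling.\<close>

definition matrix_scaleC :: "complex \<Rightarrow> complex^'n^'m \<Rightarrow> complex^'n^'m" where
  "matrix_scaleC c A = map_matrix (\<lambda>z. c * z) A"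

definition complex_linear :: "(complex^'n^'n \<Rightarrow> complex^'d^'d) \<Rightarrow> bool" where
  "complex_linear \<Phi> \<longleftrightarrow> Vector_Spaces.linear matrix_scaleC matrix_scaleC \<Phi>"

definition positive_linear :: "(complex^'n^'n \<Rightarrow> complex^'d^'d) \<Rightarrow> bool" where
  "positive_linear \<Phi> \<longleftrightarrow> complex_linear \<Phi> \<and> (\<forall>X. pos_semidef X \<longrightarrow> pos_semidef (\<Phi> X))"

definition unital :: "(complex^'n^'n \<Rightarrow> complex^'d^'d) \<Rightarrow> bool" where
  "unital \<Phi> \<longleftrightarrow> \<Phi> (mat 1) = mat 1"

lemma vector_space_matrix_scaleC: "vector_space matrix_scaleC"
  by unfold_locales (simp_all add: matrix_scaleC_def vec_eq_iff algebra_simps)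

lemma complex_linear_iff:
  "complex_linear \<Phi> \<longleftrightarrow> (\<forall>X Y. \<Phi> (X + Y) = \<Phi> X + \<Phi> Y)
     \<and> (\<forall>c X. \<Phi> (matrix_scaleC c X) = matrix_scaleC c (\<Phi> X))"
  by (simp add: complex_linear_def Vector_Spaces.linear_iff vector_space_matrix_scaleC)

lemma real_diag_mult_left: "(real_diag d ** X) $ i $ j = complex_of_real (d $ i) * X $ i $ j"
  by (simp add: real_diag_def matrix_matrix_mult_def if_distrib if_distribR cong: if_cong)

lemma real_diag_mult_right: "(X ** real_diag d) $ i $ j = X $ i $ j * complex_of_real (d $ j)"
  by (simp add: real_diag_def matrix_matrix_mult_def if_distrib if_distribR cong: if_cong)

lemma matrix_fun_diag_unique:
  assumes "unitary U" "unitary V"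
    and eq: "U ** real_diag d ** cadjoint U = V ** real_diag e ** cadjoint V"
  shows "U ** real_diag (\<chi> i. f (d $ i)) ** cadjoint U
       = V ** real_diag (\<chi> i. f (e $ i)) ** cadjoint V"
proof -
  let ?W = "cadjoint V ** U"
  have U: "cadjoint U ** U = mat 1" "U ** cadjoint U = mat 1"
    and V: "cadjoint V ** V = mat 1" "V ** cadjoint V = mat 1"
    using assms by (auto simp: unitary_def)
  have "?W ** real_diag d = cadjoint V ** (U ** real_diag d ** cadjoint U) ** U"
    by (simp add: matrix_mul_assoc[symmetric] U)
  also have "\<dots> = (cadjoint V ** V) ** real_diag e ** ?W"
    by (simp only: eq matrix_mul_assoc)
  finally have *: "?W ** real_diag d = real_diag e ** ?W"
    by (simp add: V)
  have "?W ** real_diag (\<chi> i. f (d $ i)) = real_diag (\<chi> i. f (e $ i)) ** ?W"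
  proof -
    have "?W $ i $ j * complex_of_real (f (d $ j)) = complex_of_real (f (e $ i)) * ?W $ i $ j"
      for i j
    proof -
      have "?W $ i $ j * complex_of_real (d $ j) = complex_of_real (e $ i) * ?W $ i $ j"
        using * by (metis real_diag_mult_left real_diag_mult_right)
      then have "?W $ i $ j = 0 \<or> d $ j = e $ i" by simp
      then show ?thesis by auto
    qed
    then show ?thesis
      by (simp add: vec_eq_iff real_diag_mult_left real_diag_mult_right)
  qed
  then have "V ** (?W ** real_diag (\<chi> i. f (d $ i))) ** cadjoint U
    = V ** (real_diag (\<chi> i. f (e $ i)) ** ?W) ** cadjoint U" by simp
  moreover have "V ** (?W ** X) ** cadjoint U = U ** X ** cadjoint U" for X
    by (simp add: matrix_mul_assoc V)
  moreover have "V ** (X ** ?W) ** cadjoint U = V ** X ** cadjoint V" for X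
    by (simp add: matrix_mul_assoc[symmetric] U)
  ultimately show ?thesis by metis
qed

lemma matrix_fun_diag:
  assumes "unitary U"
  shows "matrix_fun f (U ** real_diag d ** cadjoint U)
       = U ** real_diag (\<chi> i. f (d $ i)) ** cadjoint U"
  unfolding matrix_fun_def
proof (rule the_equality, goal_cases)
  case 1
  show ?case using assms by (intro exI[of _ U] exI[of _ d] conjI refl)
next
  case (2 M)
  then obtain V e where "unitary V" "U ** real_diag d ** cadjoint U = V ** real_diag e ** cadjoint V"
    and M: "M = V ** real_diag (\<chi> i. f (e $ i)) ** cadjoint V" by blast
  then show ?case using matrix_fun_diag_unique[OF assms] by metis
qed

end

theory Submission
  imports Defs
begin

text \<open>Diagonalize \<open>B\<close> with eigenvalues \<open>b\<^sub>i\<close>, put \<open>a\<^sub>i = h b\<^sub>i\<close> and \<open>w\<^sub>i = b\<^sub>i / a\<^sub>i\<close>, which is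
  increasing in \<open>b\<^sub>i\<close> because \<open>h\<close> is concave and nonnegative, and let \<open>M\<^sub>i \<ge> 0\<close> be the images of the
  spectral projections. With \<open>X = \<Sum> a\<^sub>i M\<^sub>i = \<Phi>(A)\<close>, \<open>Y = \<Sum> a\<^sub>i w\<^sub>i M\<^sub>i = \<Phi>(B)\<close>, \<open>W = \<Sum> w\<^sub>i M\<^sub>i\<close> and
  \<open>Z = \<Sum> a\<^sub>i\<^sup>2 w\<^sub>i M\<^sub>i = \<Phi>(AB)\<close>, Cauchy-Schwarz gives
  \<open>|\<langle>x, YX y\<rangle>|\<^sup>2 \<le> \<langle>x, Zx\<rangle> \<langle>y, XWX y\<rangle>\<close>. Kadison's inequality and Chebyshev's sum inequality
  for the quadratic forms at \<open>v = Xu\<close> yield \<open>\<parallel>v\<parallel>\<^sup>2 \<langle>u, XWX u\<rangle> \<le> \<parallel>u\<parallel>\<^sup>2 \<langle>v, Zv\<rangle>\<close>, so by a min-max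
  argument the ordered eigenvalues of \<open>XWX\<close> are at most those of \<open>Z\<close>, that is \<open>XWX \<le> U\<^sup>* Z U\<close> for
  a unitary \<open>U\<close>. Hence \<open>|\<langle>x, YX U\<^sup>* y\<rangle>|\<^sup>2 \<le> \<langle>x, Zx\<rangle> \<langle>y, Zy\<rangle>\<close>, and \<open>YX U\<^sup>*\<close> factors through
  \<open>Z\<^sup>1\<^sup>/\<^sup>2\<close> on both sides with a contraction in the middle.\<close>

section \<open>The complex inner product, adjoints and diagonal matrices\<close>

definition cinner :: "complex^'n \<Rightarrow> complex^'n \<Rightarrow> complex" where
  "cinner x y = (\<Sum>i\<in>UNIV. cnj (x $ i) * y $ i)"

lemma cinner_add_right: "cinner x (y + z) = cinner x y + cinner x z"
  by (simp add: cinner_def algebra_simps sum.distrib)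

lemma cinner_add_left: "cinner (x + y) z = cinner x z + cinner y z"
  by (simp add: cinner_def algebra_simps sum.distrib)

lemma cinner_diff_right: "cinner x (y - z) = cinner x y - cinner x z"
  by (simp add: cinner_def algebra_simps sum_subtractf)

lemma cinner_scale_right: "cinner x (c *s y) = c * cinner x y"
  by (simp add: cinner_def algebra_simps sum_distrib_left)

lemma cinner_scale_left: "cinner (c *s x) y = cnj c * cinner x y"
  by (simp add: cinner_def algebra_simps sum_distrib_left)

lemma cinner_zero_right [simp]: "cinner x 0 = 0"
  by (simp add: cinner_def)

lemma cinner_sum_right: "cinner x (\<Sum>i\<in>I. f i) = (\<Sum>i\<in>I. cinner x (f i))"
  by (simp add: cinner_def sum_distrib_left sum.swap[of _ UNIV])

lemma cnj_cinner: "cnj (cinner x y) = cinner y x"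
  by (simp add: cinner_def mult.commute)

text \<open>Link to the real Euclidean structure of \<open>complex^'n\<close>, in which eigenvectors
  are found by maximization.\<close>

lemma Re_cinner: "Re (cinner x y) = x \<bullet> y"
  by (simp add: cinner_def inner_vec_def inner_complex_def)

lemma cinner_self: "cinner x x = complex_of_real ((norm x)\<^sup>2)"
  by (simp add: complex_eq_iff Re_cinner power2_norm_eq_inner)
    (simp add: cinner_def mult.commute)

lemma cinner_adjoint: "cinner x (A *v y) = cinner (cadjoint A *v x) y"
  by (simp add: cinner_def matrix_vector_mult_def cadjoint_def sum_distrib_left sum_distrib_right
      ac_simps) (rule sum.swap)

lemma cadjoint_cadjoint [simp]: "cadjoint (cadjoint A) = A"
  by (simp add: cadjoint_def vec_eq_iff)

lemma cadjoint_mult: "cadjoint (A ** B) = cadjoint B ** cadjoint A"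
  by (simp add: cadjoint_def vec_eq_iff matrix_matrix_mult_def mult.commute)

lemma cadjoint_real_diag [simp]: "cadjoint (real_diag d) = real_diag d"
  by (simp add: cadjoint_def vec_eq_iff real_diag_def)

lemma hermitian_real_diag_conj: "hermitian (U ** real_diag d ** cadjoint U)"
  by (simp add: hermitian_def cadjoint_mult matrix_mul_assoc)

lemma real_diag_mult_vec: "(real_diag d *v x) $ i = complex_of_real (d $ i) * x $ i"
  by (simp add: real_diag_def matrix_vector_mult_def if_distrib if_distribR cong: if_cong)

lemma cinner_real_diag:
  "cinner x ((U ** real_diag d ** cadjoint U) *v x)
    = complex_of_real (\<Sum>i\<in>UNIV. d $ i * (cmod ((cadjoint U *v x) $ i))\<^sup>2)"
proof -
  have "cinner x ((U ** real_diag d ** cadjoint U) *v x)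
      = cinner (cadjoint U *v x) (real_diag d *v (cadjoint U *v x))"
    by (simp add: cinner_adjoint matrix_vector_mul_assoc[symmetric])
  also have "\<dots> = (\<Sum>i\<in>UNIV. complex_of_real (d $ i * (cmod ((cadjoint U *v x) $ i))\<^sup>2))"
    unfolding cinner_def
    by (intro sum.cong refl)
      (simp add: real_diag_mult_vec complex_norm_square ac_simps del: of_real_power)
  finally show ?thesis by simp
qed

lemma norm_power2_sum: "(norm (x :: complex^'n))\<^sup>2 = (\<Sum>i\<in>UNIV. (cmod (x $ i))\<^sup>2)"
  by (simp add: norm_vec_def L2_set_def sum_nonneg)

lemma unitary_cadjoint: "unitary U \<Longrightarrow> unitary (cadjoint U)"
  by (simp add: unitary_def)

lemma unitary_mult: "unitary U \<Longrightarrow> unitary V \<Longrightarrow> unitary (U ** V)"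
  by (simp add: unitary_def cadjoint_mult) (metis matrix_mul_assoc matrix_mul_rid)

lemma norm_unitary: "unitary U \<Longrightarrow> norm (U *v x) = norm x"
proof -
  assume "unitary U"
  then have "cinner (U *v x) (U *v x) = cinner x x"
    by (simp add: cinner_adjoint matrix_vector_mul_assoc unitary_def)
  then show ?thesis by (simp add: cinner_self flip: of_real_power)
qed

section \<open>The spectral theorem\<close>

text \<open>A maximizer \<open>x\<close> of the Rayleigh quotient on the compact unit sphere of
  \<open>V\<close> is an eigenvector. The form \<open>u \<bullet> (c *\<^sub>R u - f u)\<close> is
  nonnegative on \<open>V\<close> and vanishes at \<open>x\<close>, so its first variation there
  vanishes, which gives \<open>f x = c *\<^sub>R x\<close>.\<close>

lemma selfadjoint_eigenvector:
  fixes f :: "'a::euclidean_space \<Rightarrow> 'a"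
  assumes lin: "linear f" and self: "\<And>x y. x \<bullet> f y = f x \<bullet> y"
    and V: "subspace V" and inv: "\<And>x. x \<in> V \<Longrightarrow> f x \<in> V"
    and z: "z \<in> V" "z \<noteq> 0"
  obtains x c where "x \<in> V" "norm x = 1" "f x = c *\<^sub>R x"
proof -
  let ?K = "V \<inter> sphere 0 1"
  have comp: "compact ?K"
    using closed_subspace[OF V] by (simp add: closed_Int_compact)
  have ne: "?K \<noteq> {}"
  proof -
    have "(1 / norm z) *\<^sub>R z \<in> ?K" using z V by (simp add: subspace_mul)
    then show ?thesis by blast
  qed
  have "continuous_on ?K (\<lambda>x. x \<bullet> f x)"
    by (intro continuous_intros linear_continuous_on_compose[OF continuous_on_id lin])
  then obtain x where x: "x \<in> ?K" and max: "\<And>y. y \<in> ?K \<Longrightarrow> y \<bullet> f y \<le> x \<bullet> f x"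
    using continuous_attains_sup[OF comp ne] by blast
  define c where "c = x \<bullet> f x"
  define y where "y = c *\<^sub>R x - f x"
  have nonneg: "0 \<le> u \<bullet> (c *\<^sub>R u - f u)" if "u \<in> V" for u
  proof (cases "u = 0")
    case False
    have "(1 / norm u) *\<^sub>R u \<in> ?K" using False that V by (simp add: subspace_mul)
    from max[OF this] have "(u \<bullet> f u) / (norm u)\<^sup>2 \<le> c"
      using lin by (simp add: linear_scale c_def power2_eq_square)
    then show ?thesis using False
      by (simp add: inner_diff_right power2_norm_eq_inner[symmetric] field_simps)
  qed simp
  have "y \<in> V" using x V inv by (simp add: y_def subspace_diff subspace_mul)
  have xy: "x \<bullet> (c *\<^sub>R x - f x) = 0"
    using x by (simp add: c_def inner_diff_right flip: power2_norm_eq_inner)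
  define p where "p = y \<bullet> (c *\<^sub>R y - f y)"
  \<comment> \<open>Perturb \<open>x\<close> in the direction of the residual \<open>y\<close>: the
    constant term vanishes by \<open>xy\<close>, and self-adjointness makes the linear coefficient
    twice \<open>y \<bullet> y\<close>.\<close>
  have expand: "0 \<le> 2 * t * (y \<bullet> y) + t\<^sup>2 * p" for t
  proof -
    have "0 \<le> (x + t *\<^sub>R y) \<bullet> (c *\<^sub>R (x + t *\<^sub>R y) - f (x + t *\<^sub>R y))"
      using x V \<open>y \<in> V\<close> by (intro nonneg) (simp add: subspace_add subspace_mul)
    also have "c *\<^sub>R (x + t *\<^sub>R y) - f (x + t *\<^sub>R y)
        = (c *\<^sub>R x - f x) + t *\<^sub>R (c *\<^sub>R y - f y)"
      by (simp add: linear_add[OF lin] linear_scale[OF lin] algebra_simps)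
    also have "c *\<^sub>R x - f x = y"
      by (simp add: y_def)
    also have "(x + t *\<^sub>R y) \<bullet> (y + t *\<^sub>R (c *\<^sub>R y - f y))
        = x \<bullet> y + t * (x \<bullet> (c *\<^sub>R y - f y)) + t * (y \<bullet> y) + t\<^sup>2 * p"
      by (simp add: p_def inner_add_left inner_add_right power2_eq_square algebra_simps)
    also have "x \<bullet> (c *\<^sub>R y - f y) = y \<bullet> y"
      by (simp add: inner_diff_right self) (simp add: y_def inner_diff_left inner_commute)
    also have "x \<bullet> y = 0" using xy by (simp add: y_def)
    finally show ?thesis by simp
  qed
  have "y \<bullet> y = 0"
  proof (rule ccontr)
    assume *: "y \<bullet> y \<noteq> 0"
    then have pos: "y \<bullet> y > 0" by simp
    \<comment> \<open>Negative, and so small that the quadratic term cannot outweigh the linear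
      one.\<close>
    define t where "t = - (y \<bullet> y) / (1 + \<bar>p\<bar>)"
    have "t * (2 * (y \<bullet> y) + t * p) \<ge> 0" using expand[of t]
      by (simp add: power2_eq_square algebra_simps)
    moreover have "t < 0" using pos by (simp add: t_def divide_neg_pos)
    ultimately have "2 * (y \<bullet> y) + t * p \<le> 0" by (simp add: zero_le_mult_iff)
    moreover have "\<bar>t * p\<bar> \<le> y \<bullet> y"
    proof -
      have "\<bar>t * p\<bar> = (y \<bullet> y) * (\<bar>p\<bar> / (1 + \<bar>p\<bar>))"
        using pos by (simp add: t_def abs_mult)
      also have "\<dots> \<le> (y \<bullet> y) * 1"
        using pos by (intro mult_left_mono) auto
      finally show ?thesis by simp
    qed
    ultimately show False using pos by linarith
  qed
  then show ?thesis using that[of x c] x by (simp add: y_def)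
qed

text \<open>By induction on \<open>k\<close>: the orthogonal complement of the eigenvectors found so
  far is invariant under \<open>A\<close>, so it contains a further unit eigenvector.\<close>

lemma hermitian_orthonormal_eigenvectors:
  fixes A :: "complex^'n^'n"
  assumes A: "hermitian A" and "k \<le> CARD('n)"
  shows "\<exists>S. finite S \<and> card S = k
    \<and> (\<forall>s\<in>S. \<exists>c. A *v s = complex_of_real c *s s)
    \<and> (\<forall>s\<in>S. \<forall>t\<in>S. cinner s t = (if s = t then 1 else 0))"
  using assms(2)
proof (induction k)
  case 0
  show ?case by (intro exI[of _ "{}"]) simp
next
  case (Suc k)
  then obtain S where S: "finite S" "card S = k"
    and eig: "\<And>s. s \<in> S \<Longrightarrow> \<exists>c. A *v s = complex_of_real c *s s"
    and on: "\<And>s t. s \<in> S \<Longrightarrow> t \<in> S \<Longrightarrow> cinner s t = (if s = t then 1 else 0)"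
    by auto
  \<comment> \<open>The complement is taken for the complex inner product but used as a real
    subspace. The real maximization thus returns a vector that is orthogonal to \<open>S\<close>
    over the complex numbers.\<close>
  define V where "V = {x. \<forall>s\<in>S. cinner s x = 0}"
  have V: "subspace V"
    by (auto simp: V_def subspace_def cinner_add_right)
      (simp add: cinner_def flip: sum_distrib_left scaleR_conv_of_real scaleR_sum_right)
  have "vec.span S \<noteq> UNIV"
  proof
    assume "vec.span S = UNIV"
    then have "vec.dim (UNIV :: (complex^'n) set) \<le> card S"
      by (intro vec.dim_le_card) (use S in auto)
    then show False using Suc.prems S by (simp add: card_cart_basis)
  qed
  then obtain x where x: "x \<notin> vec.span S" by blast
  \<comment> \<open>The Gram-Schmidt residual of a vector outside the span is a nonzero element of
    \<open>V\<close>.\<close>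
  define z where "z = x - (\<Sum>s\<in>S. cinner s x *s s)"
  have "z \<noteq> 0"
  proof
    assume "z = 0"
    then have "x = (\<Sum>s\<in>S. cinner s x *s s)" by (simp add: z_def)
    then show False using x
      by (metis (no_types, lifting) vec.span_base vec.span_scale vec.span_sum)
  qed
  have "z \<in> V"
    using S by (auto simp: V_def z_def cinner_diff_right cinner_sum_right cinner_scale_right on
        if_distrib cong: if_cong)
  have self: "x \<bullet> (A *v y) = (A *v x) \<bullet> y" for x y
    using A by (simp add: cinner_adjoint hermitian_def flip: Re_cinner)
  have inv: "A *v x \<in> V" if "x \<in> V" for x
  proof -
    have "cinner s (A *v x) = 0" if s: "s \<in> S" for s
    proof -
      obtain c where "A *v s = complex_of_real c *s s" using eig[OF s] by blast
      then show ?thesis using A \<open>x \<in> V\<close> s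
        by (simp add: cinner_adjoint hermitian_def cinner_scale_left V_def)
    qed
    then show ?thesis by (simp add: V_def)
  qed
  obtain y c where y: "y \<in> V" "norm y = 1" "A *v y = c *\<^sub>R y"
    using selfadjoint_eigenvector[OF matrix_vector_mul_linear self V inv \<open>z \<in> V\<close> \<open>z \<noteq> 0\<close>]
    by metis
  have "A *v y = complex_of_real c *s y"
    using y(3) by (simp add: vec_eq_iff) (simp add: scaleR_conv_of_real)
  moreover have "y \<notin> S" using y on by (auto simp: V_def)
  moreover have "cinner y s = 0" if "s \<in> S" for s
    using y(1) that cnj_cinner[of s y] by (simp add: V_def)
  moreover have "cinner y y = 1" by (simp add: cinner_self y)
  ultimately show ?case
    using S eig on y(1) by (intro exI[of _ "insert y S"]) (auto simp: V_def)
qed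

text \<open>An orthonormal family of \<open>CARD('n)\<close> eigenvectors, indexed by
  \<open>'n\<close>, supplies the columns of \<open>U\<close>.\<close>

theorem hermitian_diagonalize:
  fixes A :: "complex^'n^'n"
  assumes "hermitian A"
  obtains U d where "unitary U" "A = U ** real_diag d ** cadjoint U"
proof -
  obtain S where S: "finite S" "card S = CARD('n)"
    and eig: "\<forall>s\<in>S. \<exists>c. A *v s = complex_of_real c *s s"
    and on: "\<forall>s\<in>S. \<forall>t\<in>S. cinner s t = (if s = t then 1 else 0)"
    using hermitian_orthonormal_eigenvectors[OF assms order.refl] by blast
  obtain e where e: "bij_betw e (UNIV :: 'n set) S"
    using S finite_same_card_bij[of "UNIV :: 'n set" S] by auto
  obtain c where c: "\<And>s. s \<in> S \<Longrightarrow> A *v s = complex_of_real (c s) *s s"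
    using eig by metis
  have eS: "e i \<in> S" for i using e by (auto simp: bij_betw_def)
  have e_eq: "e i = e j \<longleftrightarrow> i = j" for i j using e by (auto simp: bij_betw_def inj_on_def)
  define U :: "complex^'n^'n" where "U = (\<chi> i j. e j $ i)"
  define d where "d = (\<chi> i. c (e i))"
  have UU: "cadjoint U ** U = mat 1"
  proof -
    have "(cadjoint U ** U) $ i $ j = cinner (e i) (e j)" for i j
      by (simp add: matrix_matrix_mult_def cadjoint_def U_def cinner_def)
    then have "(cadjoint U ** U) $ i $ j = mat 1 $ i $ j" for i j
      using on eS by (simp add: e_eq mat_def)
    then show ?thesis by (simp add: vec_eq_iff)
  qed
  then have U: "unitary U"
    by (simp add: unitary_def matrix_left_right_inverse)
  have "A ** U = U ** real_diag d"
  proof -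
    have "(A ** U) $ i $ j = (A *v e j) $ i" for i j
      by (simp add: matrix_matrix_mult_def matrix_vector_mult_def U_def)
    then show ?thesis
      by (simp add: vec_eq_iff real_diag_mult_right c eS) (simp add: U_def d_def)
  qed
  then have "A ** U ** cadjoint U = U ** real_diag d ** cadjoint U" by simp
  then have "A = U ** real_diag d ** cadjoint U"
    using U by (simp add: unitary_def flip: matrix_mul_assoc)
  with U show ?thesis by (rule that)
qed

section \<open>Positive semidefinite matrices and their square roots\<close>

lemma pos_semidef_iff:
  "pos_semidef A \<longleftrightarrow> hermitian A \<and> (\<forall>x. 0 \<le> Re (cinner x (A *v x)))"
  by (simp add: pos_semidef_def cinner_def)

lemma cinner_diag_column:
  assumes "unitary U"
  shows "Re (cinner (U *v axis i 1) ((U ** real_diag d ** cadjoint U) *v (U *v axis i 1))) = d $ i"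
proof -
  have "cadjoint U *v (U *v axis i 1) = axis i 1"
    using assms by (simp add: matrix_vector_mul_assoc unitary_def)
  then show ?thesis
    by (simp add: cinner_real_diag axis_def if_distrib[of cmod] if_distrib[of "\<lambda>x. x\<^sup>2"]
        if_distrib[of "(*) _"] cong: if_cong)
qed

lemma pos_semidef_real_diag_conj:
  assumes "unitary U"
  shows "pos_semidef (U ** real_diag d ** cadjoint U) \<longleftrightarrow> (\<forall>i. 0 \<le> d $ i)"
proof
  assume "pos_semidef (U ** real_diag d ** cadjoint U)"
  then show "\<forall>i. 0 \<le> d $ i"
    using cinner_diag_column[OF assms] by (metis pos_semidef_iff)
next
  assume "\<forall>i. 0 \<le> d $ i"
  then show "pos_semidef (U ** real_diag d ** cadjoint U)"
    by (auto simp: pos_semidef_iff hermitian_real_diag_conj cinner_real_diag intro!: sum_nonneg)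
qed

lemma pos_semidef_diagonalize:
  assumes "pos_semidef A"
  obtains U d where "unitary U" "\<And>i. 0 \<le> d $ i" "A = U ** real_diag d ** cadjoint U"
  using assms hermitian_diagonalize pos_semidef_iff pos_semidef_real_diag_conj by metis

lemma real_diag_mult: "real_diag d ** real_diag e = real_diag (\<chi> i. d $ i * e $ i)"
  by (simp add: vec_eq_iff real_diag_mult_left) (simp add: real_diag_def)

lemma real_diag_conj_mult:
  assumes "unitary U"
  shows "(U ** real_diag d ** cadjoint U) ** (U ** real_diag e ** cadjoint U)
    = U ** real_diag (\<chi> i. d $ i * e $ i) ** cadjoint U"
proof -
  have "(U ** real_diag d ** cadjoint U) ** (U ** real_diag e ** cadjoint U)
      = U ** real_diag d ** (cadjoint U ** U) ** real_diag e ** cadjoint U"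
    by (simp add: matrix_mul_assoc)
  then show ?thesis using assms
    by (simp add: unitary_def) (simp add: real_diag_mult flip: matrix_mul_assoc)
qed

lemma norm_cinner_le: "cmod (cinner x y) \<le> norm x * norm y"
proof -
  have "cmod (cinner x y) \<le> (\<Sum>i\<in>UNIV. \<bar>cmod (x $ i)\<bar> * \<bar>cmod (y $ i)\<bar>)"
    unfolding cinner_def by (rule order_trans[OF norm_sum]) (simp add: norm_mult)
  also have "\<dots> \<le> norm x * norm y"
    unfolding norm_vec_def by (rule L2_set_mult_ineq)
  finally show ?thesis .
qed

lemma hermitian_matrix_sqrt: "pos_semidef A \<Longrightarrow> hermitian (matrix_sqrt A)"
  by (metis pos_semidef_diagonalize matrix_fun_diag matrix_sqrt_def hermitian_real_diag_conj)

lemma matrix_sqrt_mult_self: "pos_semidef A \<Longrightarrow> matrix_sqrt A ** matrix_sqrt A = A"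
proof (erule pos_semidef_diagonalize)
  fix U and d :: "real^'a"
  assume "unitary U" "\<And>i. 0 \<le> d $ i" "A = U ** real_diag d ** cadjoint U"
  then show ?thesis
    by (simp add: matrix_sqrt_def matrix_fun_diag real_diag_conj_mult)
qed

text \<open>Reduces Cauchy-Schwarz for the form of \<open>A\<close> to the ordinary one.\<close>

lemma cinner_matrix_sqrt:
  "pos_semidef A \<Longrightarrow> cinner x (A *v y) = cinner (matrix_sqrt A *v x) (matrix_sqrt A *v y)"
  by (metis cinner_adjoint hermitian_def hermitian_matrix_sqrt matrix_sqrt_mult_self
      matrix_vector_mul_assoc)

lemma norm_matrix_sqrt:
  "pos_semidef A \<Longrightarrow> (norm (matrix_sqrt A *v x))\<^sup>2 = Re (cinner x (A *v x))"
  by (simp add: cinner_matrix_sqrt cinner_self)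

lemma cinner_ext: "(\<And>x. cinner x y = cinner x z) \<Longrightarrow> y = z"
  using cinner_diff_right[of "y - z" y z] cinner_self[of "y - z"] by simp

text \<open>If \<open>Z\<close> is invertible, take \<open>T\<close> multiplied on both sides by the
  inverse of the root. In general a pseudoinverse \<open>G\<close> replaces the inverse; nothing is
  lost, because the bound makes the form of \<open>T\<close> vanish as soon as one argument lies in
  the kernel of \<open>Z\<close>.\<close>

lemma factor_through_matrix_sqrt:
  assumes Z: "pos_semidef Z"
    and bound: "\<And>x y. (cmod (cinner x (T *v y)))\<^sup>2
      \<le> Re (cinner x (Z *v x)) * Re (cinner y (Z *v y))"
  shows "\<exists>K. contraction K \<and> T = matrix_sqrt Z ** K ** matrix_sqrt Z"
proof -
  obtain Q z where Q: "unitary Q" and z: "\<And>i. 0 \<le> z $ i" and Zeq: "Z = Q ** real_diag z ** cadjoint Q"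
    using pos_semidef_diagonalize[OF Z] by metis
  define R where "R = matrix_sqrt Z"
  \<comment> \<open>As \<open>inverse 0 = 0\<close>, this is the Moore-Penrose inverse of
    \<open>R\<close>, and \<open>P\<close> below is the orthogonal projection onto the range of
    \<open>Z\<close>.\<close>
  define G where "G = Q ** real_diag (\<chi> i. inverse (sqrt (z $ i))) ** cadjoint Q"
  define P where "P = Q ** real_diag (\<chi> i. if z $ i = 0 then 0 else 1) ** cadjoint Q"
  have R: "R = Q ** real_diag (\<chi> i. sqrt (z $ i)) ** cadjoint Q"
    using Q by (simp add: R_def matrix_sqrt_def Zeq matrix_fun_diag)
  have RG: "R ** G = P" and GR: "G ** R = P" and RP: "R ** P = R"
    unfolding R G_def P_def real_diag_conj_mult[OF Q]
    by (rule arg_cong[of _ _ "\<lambda>d. Q ** real_diag d ** cadjoint Q"], simp add: vec_eq_iff)+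
  have herm: "cadjoint R = R" "cadjoint G = G" "cadjoint P = P"
    using hermitian_real_diag_conj unfolding hermitian_def R G_def P_def by blast+
  have P_le: "norm (P *v x) \<le> norm x" for x
  proof -
    have "norm (P *v x) = norm (real_diag (\<chi> i. if z $ i = 0 then 0 else 1) *v (cadjoint Q *v x))"
      using norm_unitary[OF Q] by (simp add: P_def flip: matrix_vector_mul_assoc)
    also have "\<dots> \<le> norm (cadjoint Q *v x)"
      by (rule norm_le_componentwise_cart) (simp add: real_diag_mult_vec)
    finally show ?thesis using norm_unitary[OF unitary_cadjoint[OF Q]] by simp
  qed
  have bound': "cmod (cinner x (T *v y)) \<le> norm (R *v x) * norm (R *v y)" for x y
    using bound[of x y]
    by (simp add: R_def flip: norm_matrix_sqrt[OF Z] power_mult_distrib)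
  have R0: "R *v (x - P *v x) = 0" for x
    by (simp add: matrix_vector_mult_diff_distrib matrix_vector_mul_assoc RP)
  have TP: "T *v y = P *v (T *v (P *v y))" for y
  proof (rule cinner_ext)
    fix x
    have "cinner x (T *v (y - P *v y)) = 0" using bound'[of x "y - P *v y"] by (simp add: R0)
    moreover have "cinner (x - P *v x) (T *v (P *v y)) = 0"
      using bound'[of "x - P *v x" "P *v y"] by (simp add: R0)
    moreover have "cinner (x - P *v x) u = cinner x u - cinner x (P *v u)" for u
      using cinner_add_left[of "x - P *v x" "P *v x" u] by (simp add: cinner_adjoint herm)
    ultimately show "cinner x (T *v y) = cinner x (P *v (T *v (P *v y)))"
      by (simp add: matrix_vector_mult_diff_distrib cinner_diff_right)
  qed
  define K where "K = G ** T ** G"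
  have "norm (K *v x) \<le> norm x" for x
  proof (cases "K *v x = 0")
    case False
    \<comment> \<open>Testing \<open>K *v x\<close> against itself moves one \<open>G\<close> to the
      left, where the bound applies; each product \<open>R ** G\<close> is the norm-decreasing
      \<open>P\<close>.\<close>
    have "cmod (cinner (K *v x) (K *v x)) = cmod (cinner (G *v (K *v x)) (T *v (G *v x)))"
      by (simp add: K_def cinner_adjoint[of _ G] herm flip: matrix_vector_mul_assoc)
    also have "\<dots> \<le> norm (R *v (G *v (K *v x))) * norm (R *v (G *v x))"
      by (rule bound')
    also have "\<dots> \<le> norm (K *v x) * norm x"
      using P_le by (intro mult_mono) (simp_all add: RG matrix_vector_mul_assoc[of R G])
    finally show ?thesis using False by (simp add: cinner_self power2_eq_square norm_mult)
  qed simp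
  then have "contraction K" unfolding contraction_def by (intro onorm_le) simp
  moreover have "T = R ** K ** R"
    unfolding matrix_eq
  proof
    fix y
    have "T *v y = (R ** G) *v (T *v ((G ** R) *v y))" using TP[of y] by (simp add: RG GR)
    then show "T *v y = (R ** K ** R) *v y"
      by (simp add: K_def flip: matrix_vector_mul_assoc)
  qed
  ultimately show ?thesis unfolding R_def by blast
qed

section \<open>Comparison of eigenvalues\<close>

text \<open>The counting condition says that the k-th largest value of \<open>m\<close> is at most
  the k-th largest value of \<open>z\<close>. The matching is greedy: pair the two maxima, delete
  them and recurse.\<close>

lemma dominating_bijection:
  fixes m :: "'a \<Rightarrow> real" and z :: "'b \<Rightarrow> real"
  assumes "finite A" "finite B" "card A = card B"
    and "\<And>\<mu>. card {i\<in>A. \<mu> \<le> m i} \<le> card {j\<in>B. \<mu> \<le> z j}"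
  shows "\<exists>\<pi>. bij_betw \<pi> A B \<and> (\<forall>i\<in>A. m i \<le> z (\<pi> i))"
  using assms
proof (induction "card A" arbitrary: A B)
  case 0
  then show ?case by (auto simp: bij_betw_def)
next
  case (Suc n)
  have ex_maximal: "\<exists>x\<in>S. \<forall>y\<in>S. f y \<le> f x" if "finite S" "S \<noteq> {}"
    for S and f :: "'c \<Rightarrow> real"
    using that Max_in[of "f ` S"] Max_ge[of "f ` S"] by fastforce
  obtain a where a: "a \<in> A" and a_max: "\<And>i. i \<in> A \<Longrightarrow> m i \<le> m a"
    using ex_maximal[of A m] Suc.hyps(2) Suc.prems by force
  obtain b where b: "b \<in> B" and b_max: "\<And>j. j \<in> B \<Longrightarrow> z j \<le> z b"
    using ex_maximal[of B z] Suc.hyps(2) Suc.prems by force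
  have ab: "m a \<le> z b"
  proof -
    have "0 < card {i\<in>A. m a \<le> m i}" using a Suc.prems(1) by (auto simp: card_gt_0_iff)
    then have "{j\<in>B. m a \<le> z j} \<noteq> {}" using Suc.prems(4)[of "m a"] by force
    then show ?thesis using b_max by force
  qed
  \<comment> \<open>For levels up to \<open>m a\<close> both counts drop by one; above it the left
    count is zero.\<close>
  have "card {i\<in>A - {a}. \<mu> \<le> m i} \<le> card {j\<in>B - {b}. \<mu> \<le> z j}" for \<mu>
  proof (cases "\<mu> \<le> m a")
    case True
    have "{i\<in>A - {a}. \<mu> \<le> m i} = {i\<in>A. \<mu> \<le> m i} - {a}"
      "{j\<in>B - {b}. \<mu> \<le> z j} = {j\<in>B. \<mu> \<le> z j} - {b}" by auto
    then show ?thesis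
      using Suc.prems a b ab True by (simp add: card_Diff_singleton diff_le_mono)
  next
    case False
    then have "{i\<in>A - {a}. \<mu> \<le> m i} = {}" using a_max by force
    then show ?thesis by (metis card.empty le0)
  qed
  then have "\<exists>\<pi>. bij_betw \<pi> (A - {a}) (B - {b}) \<and> (\<forall>i\<in>A - {a}. m i \<le> z (\<pi> i))"
    using Suc.hyps(2) Suc.prems(1-3) a b by (intro Suc.hyps(1)) auto
  then obtain \<pi> where \<pi>: "bij_betw \<pi> (A - {a}) (B - {b})" "\<forall>i\<in>A - {a}. m i \<le> z (\<pi> i)"
    by blast
  have "bij_betw (\<pi>(a := b)) (insert a (A - {a})) (insert b (B - {b}))"
    using \<pi>(1) by (auto simp: bij_betw_def inj_on_def)
  then have "bij_betw (\<pi>(a := b)) A B" using a b by (simp add: insert_absorb)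
  then show ?case using \<pi>(2) ab by (intro exI[of _ "\<pi>(a := b)"]) auto
qed

text \<open>Dimension count: vectors supported on \<open>I\<close> form a space of dimension
  \<open>card I\<close>, and only \<open>card J\<close> linear conditions are imposed.\<close>

lemma supported_kernel_vector:
  fixes L :: "complex^'d^'e"
  assumes "card J < card I"
  obtains c where "c \<noteq> 0" "\<And>i. i \<notin> I \<Longrightarrow> c $ i = 0" "\<And>j. j \<in> J \<Longrightarrow> (L *v c) $ j = 0"
proof -
  \<comment> \<open>Clearing the rows outside \<open>J\<close> puts the image inside a coordinate
    subspace of dimension \<open>card J\<close>.\<close>
  define L' :: "complex^'d^'e" where "L' = (\<chi> i j. if i \<in> J then L $ i $ j else 0)"
  define S where "S = {c :: complex^'d. \<forall>i. i \<notin> I \<longrightarrow> c $ i = 0}"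
  have L': "(L' *v c) $ j = (if j \<in> J then (L *v c) $ j else 0)" for c j
    by (simp add: L'_def matrix_vector_mult_def)
  have S: "vec.subspace S" by (auto simp: S_def vec.subspace_def)
  have "\<not> inj_on ((*v) L') S"
  proof
    assume "inj_on ((*v) L') S"
    then have "vec.dim ((*v) L' ` S) = vec.dim S"
      using S by (intro vec.dim_image_eq matrix_vector_mul_linear_gen) (simp add: vec.span_eq_iff[THEN iffD2])
    moreover have "vec.dim ((*v) L' ` S) \<le> vec.dim {c :: complex^'e. \<forall>i. i \<notin> J \<longrightarrow> c $ i = 0}"
      by (rule vec.dim_subset) (auto simp: L')
    ultimately show False using assms by (simp add: S_def dim_substandard_cart)
  qed
  then obtain x y where xy: "x \<in> S" "y \<in> S" "L' *v x = L' *v y" "x \<noteq> y"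
    by (auto simp: inj_on_def)
  have "L' *v (x - y) = 0" using xy by (simp add: matrix_vector_mult_diff_distrib)
  then have "(L *v (x - y)) $ j = 0" if "j \<in> J" for j
    using that L'[of "x - y" j] by simp
  moreover have "x - y \<noteq> 0" "(x - y) $ i = 0" if "i \<notin> I" for i
    using xy that by (auto simp: S_def)
  ultimately show ?thesis using that[of "x - y"] xy by (auto simp: S_def)
qed

text \<open>The min-max argument. If the count failed, some nonzero \<open>u\<close> would lie in
  the span of the eigenvectors of \<open>H\<close> with eigenvalue at least \<open>\<mu>\<close>,
  while \<open>X *v u\<close> is orthogonal to those of \<open>Z\<close> with eigenvalue at least
  \<open>\<mu>\<close>. The two forms then contradict \<open>le\<close>.\<close>

lemma card_eigenvalues_le:
  fixes X :: "complex^'d^'d"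
  assumes P: "unitary P" and Q: "unitary Q" and z: "\<And>i. 0 \<le> z $ i"
    and H: "H = P ** real_diag m ** cadjoint P" and Z: "Z = Q ** real_diag z ** cadjoint Q"
    and zero: "\<And>u. X *v u = 0 \<Longrightarrow> cinner u (H *v u) = 0"
    and le: "\<And>u. (norm (X *v u))\<^sup>2 * Re (cinner u (H *v u))
      \<le> (norm u)\<^sup>2 * Re (cinner (X *v u) (Z *v (X *v u)))"
  shows "card {i. \<mu> \<le> m $ i} \<le> card {i. \<mu> \<le> z $ i}"
proof (cases "\<mu> \<le> 0")
  case True
  then have "{i. \<mu> \<le> z $ i} = UNIV" using z by (auto intro: order_trans)
  then show ?thesis by (simp add: card_mono)
next
  case False
  show ?thesis
  proof (rule ccontr)
    assume "\<not> ?thesis"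
    then obtain c where c: "c \<noteq> 0" "\<And>i. i \<notin> {i. \<mu> \<le> m $ i} \<Longrightarrow> c $ i = 0"
      and Lc: "\<And>j. j \<in> {i. \<mu> \<le> z $ i} \<Longrightarrow> ((cadjoint Q ** X ** P) *v c) $ j = 0"
      using supported_kernel_vector[of "{i. \<mu> \<le> z $ i}" "{i. \<mu> \<le> m $ i}" "cadjoint Q ** X ** P"]
      by (metis not_le)
    \<comment> \<open>\<open>c\<close> and \<open>y\<close> are the coordinates of \<open>u\<close>
      and \<open>v\<close> in the eigenbases of \<open>H\<close> and \<open>Z\<close>.\<close>
    define u where "u = P *v c"
    define v where "v = X *v u"
    define y where "y = cadjoint Q *v v"
    have Pu: "cadjoint P *v u = c"
      using P by (simp add: u_def matrix_vector_mul_assoc unitary_def)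
    have u: "norm u = norm c" using P by (simp add: u_def norm_unitary)
    have v: "norm v = norm y" using Q by (simp add: y_def norm_unitary unitary_cadjoint)
    have y0: "y $ j = 0" if "\<mu> \<le> z $ j" for j
      using Lc[of j] that by (simp add: y_def v_def u_def flip: matrix_vector_mul_assoc)
    have Hu: "\<mu> * (norm u)\<^sup>2 \<le> Re (cinner u (H *v u))"
      unfolding u H cinner_real_diag Pu norm_power2_sum
      using c(2) by (auto simp: sum_distrib_left mult_right_mono intro!: sum_mono)
        (metis mult_right_mono mult_zero_right norm_zero order.refl power_zero_numeral zero_le_power2)
    moreover have "0 < \<mu> * (norm u)\<^sup>2" using False c(1) u by simp
    \<comment> \<open>Needed for the strict inequality in the form of \<open>Z\<close>
      below.\<close>
    ultimately have "v \<noteq> 0" using zero[of u] by (auto simp: v_def)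
    then obtain j where j: "y $ j \<noteq> 0" using v by (metis norm_eq_zero vec_eq_iff zero_index)
    have "Re (cinner v (Z *v v)) < \<mu> * (norm v)\<^sup>2"
      unfolding v Z cinner_real_diag norm_power2_sum y_def[symmetric] sum_distrib_left Re_complex_of_real
    proof (rule sum_strict_mono_ex1)
      show "\<forall>i\<in>UNIV. z $ i * (cmod (y $ i))\<^sup>2 \<le> \<mu> * (cmod (y $ i))\<^sup>2"
        using y0 by (metis mult_right_mono mult_zero_right nle_le norm_zero zero_le_power2 power_zero_numeral)
      show "\<exists>i\<in>UNIV. z $ i * (cmod (y $ i))\<^sup>2 < \<mu> * (cmod (y $ i))\<^sup>2"
        using j y0[of j] by (intro bexI[of _ j]) (auto simp: not_le[symmetric])
    qed simp
    then have "(norm u)\<^sup>2 * Re (cinner v (Z *v v)) < (norm u)\<^sup>2 * (\<mu> * (norm v)\<^sup>2)"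
      using c(1) u by simp
    also have "\<dots> \<le> (norm v)\<^sup>2 * Re (cinner u (H *v u))"
      using mult_left_mono[OF Hu, of "(norm v)\<^sup>2"] by (simp add: ac_simps)
    finally show False using le[of u] by (simp add: v_def)
  qed
qed

text \<open>\<open>U\<close> carries each eigenvector of \<open>H\<close> to the eigenvector of
  \<open>Z\<close> matched with it, whose eigenvalue is at least as large.\<close>

lemma unitary_domination:
  fixes X :: "complex^'d^'d"
  assumes H: "pos_semidef H" and Z: "pos_semidef Z"
    and zero: "\<And>u. X *v u = 0 \<Longrightarrow> cinner u (H *v u) = 0"
    and le: "\<And>u. (norm (X *v u))\<^sup>2 * Re (cinner u (H *v u))
      \<le> (norm u)\<^sup>2 * Re (cinner (X *v u) (Z *v (X *v u)))"
  obtains U where "unitary U"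
    "\<And>y. Re (cinner y (H *v y)) \<le> Re (cinner (U *v y) (Z *v (U *v y)))"
proof -
  obtain P m where P: "unitary P" and Heq: "H = P ** real_diag m ** cadjoint P"
    using pos_semidef_diagonalize[OF H] by metis
  obtain Q z where Q: "unitary Q" and z: "\<And>i. 0 \<le> z $ i" and Zeq: "Z = Q ** real_diag z ** cadjoint Q"
    using pos_semidef_diagonalize[OF Z] by metis
  obtain \<pi> where \<pi>: "bij \<pi>" and mz: "\<And>i. m $ i \<le> z $ \<pi> i"
    using dominating_bijection[of UNIV UNIV "($) m" "($) z"]
      card_eigenvalues_le[OF P Q z Heq Zeq zero le] by auto
  \<comment> \<open>The columns of \<open>Q\<close> in the order of the matching, so that column
    \<open>i\<close> belongs to the eigenvalue \<open>z $ \<pi> i\<close>.\<close>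
  define Q' where "Q' = (\<chi> i j. Q $ i $ \<pi> j)"
  have Q'_row: "(cadjoint Q' *v x) $ i = (cadjoint Q *v x) $ \<pi> i" for x i
    by (simp add: Q'_def cadjoint_def matrix_vector_mult_def)
  have "cadjoint Q' ** Q' = mat 1"
  proof -
    have "(cadjoint Q' ** Q') $ i $ j = (cadjoint Q ** Q) $ \<pi> i $ \<pi> j" for i j
      by (simp add: Q'_def cadjoint_def matrix_matrix_mult_def)
    then show ?thesis
      using Q \<pi> by (simp add: vec_eq_iff unitary_def mat_def bij_def inj_eq)
  qed
  then have Q': "unitary Q'" by (simp add: unitary_def matrix_left_right_inverse)
  define U where "U = Q' ** cadjoint P"
  have "Re (cinner y (H *v y)) \<le> Re (cinner (U *v y) (Z *v (U *v y)))" for y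
  proof -
    have "cadjoint Q' *v (U *v y) = cadjoint P *v y"
      using Q' by (simp add: U_def matrix_vector_mul_assoc unitary_def matrix_mul_assoc)
    then have *: "(cadjoint Q *v (U *v y)) $ \<pi> i = (cadjoint P *v y) $ i" for i
      by (simp flip: Q'_row)
    have "Re (cinner y (H *v y)) = (\<Sum>i\<in>UNIV. m $ i * (cmod ((cadjoint P *v y) $ i))\<^sup>2)"
      by (simp add: Heq cinner_real_diag)
    also have "\<dots> \<le> (\<Sum>i\<in>UNIV. z $ \<pi> i * (cmod ((cadjoint Q *v (U *v y)) $ \<pi> i))\<^sup>2)"
      unfolding * using mz by (intro sum_mono mult_right_mono) auto
    also have "\<dots> = (\<Sum>i\<in>UNIV. z $ i * (cmod ((cadjoint Q *v (U *v y)) $ i))\<^sup>2)"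
      using \<pi> by (rule sum.reindex_bij_betw)
    also have "\<dots> = Re (cinner (U *v y) (Z *v (U *v y)))"
      by (simp add: Zeq cinner_real_diag)
    finally show ?thesis .
  qed
  moreover have "unitary U" using P Q' by (simp add: U_def unitary_mult unitary_cadjoint)
  ultimately show ?thesis using that by blast
qed

section \<open>Weighted sums of positive semidefinite matrices\<close>

text \<open>When the \<open>M i\<close> are positive semidefinite with sum \<open>mat 1\<close>,
  this is integration of \<open>p\<close> against a finite positive operator-valued measure.\<close>

definition weighted_sum :: "('i::finite \<Rightarrow> complex^'d^'d) \<Rightarrow> ('i \<Rightarrow> real) \<Rightarrow> complex^'d^'d" where
  "weighted_sum M p = (\<Sum>i\<in>UNIV. matrix_scaleC (complex_of_real (p i)) (M i))"

lemma matrix_scaleC_mult_vec: "matrix_scaleC c A *v x = c *s (A *v x)"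
  by (simp add: matrix_scaleC_def map_matrix_def vec_eq_iff matrix_vector_mult_def
      sum_distrib_left mult.assoc)

lemma sum_matrix_mult_vec: "(\<Sum>i\<in>I. A i) *v x = (\<Sum>i\<in>I. A i *v x)"
  by (induction I rule: infinite_finite_induct) (simp_all add: matrix_vector_mult_add_rdistrib)

lemma cinner_weighted_sum:
  "cinner x (weighted_sum M p *v y) = (\<Sum>i\<in>UNIV. complex_of_real (p i) * cinner x (M i *v y))"
  by (simp add: weighted_sum_def sum_matrix_mult_vec matrix_scaleC_mult_vec cinner_sum_right
      cinner_scale_right)

lemma Re_cinner_weighted_sum:
  "Re (cinner x (weighted_sum M p *v y)) = (\<Sum>i\<in>UNIV. p i * Re (cinner x (M i *v y)))"
  by (simp add: cinner_weighted_sum)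

text \<open>Cauchy-Schwarz twice: in the form of each \<open>M i\<close>, then in the sum over
  \<open>i\<close>.\<close>

lemma weighted_sum_Cauchy_Schwarz:
  assumes M: "\<And>i. pos_semidef (M i)"
  shows "(cmod (cinner x (weighted_sum M (\<lambda>i. p i * q i) *v y)))\<^sup>2
    \<le> Re (cinner x (weighted_sum M (\<lambda>i. (p i)\<^sup>2) *v x))
      * Re (cinner y (weighted_sum M (\<lambda>i. (q i)\<^sup>2) *v y))"
proof -
  define R where "R i = matrix_sqrt (M i)" for i
  have "cmod (cinner x (weighted_sum M (\<lambda>i. p i * q i) *v y))
      \<le> (\<Sum>i\<in>UNIV. cmod (complex_of_real (p i * q i) * cinner x (M i *v y)))"
    unfolding cinner_weighted_sum by (rule norm_sum)
  also have "\<dots> \<le> (\<Sum>i\<in>UNIV. \<bar>p i * norm (R i *v x)\<bar> * \<bar>q i * norm (R i *v y)\<bar>)"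
  proof (rule sum_mono)
    fix i
    have "cmod (cinner x (M i *v y)) \<le> norm (R i *v x) * norm (R i *v y)"
      unfolding R_def cinner_matrix_sqrt[OF M] by (rule norm_cinner_le)
    then have "(\<bar>p i\<bar> * \<bar>q i\<bar>) * cmod (cinner x (M i *v y))
        \<le> (\<bar>p i\<bar> * \<bar>q i\<bar>) * (norm (R i *v x) * norm (R i *v y))"
      by (rule mult_left_mono) simp
    then show "cmod (complex_of_real (p i * q i) * cinner x (M i *v y))
        \<le> \<bar>p i * norm (R i *v x)\<bar> * \<bar>q i * norm (R i *v y)\<bar>"
      by (simp add: norm_mult abs_mult ac_simps)
  qed
  also have "\<dots> \<le> L2_set (\<lambda>i. p i * norm (R i *v x)) UNIV * L2_set (\<lambda>i. q i * norm (R i *v y)) UNIV"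
    by (rule L2_set_mult_ineq)
  finally have "(cmod (cinner x (weighted_sum M (\<lambda>i. p i * q i) *v y)))\<^sup>2
      \<le> (L2_set (\<lambda>i. p i * norm (R i *v x)) UNIV * L2_set (\<lambda>i. q i * norm (R i *v y)) UNIV)\<^sup>2"
    by (simp add: power_mono)
  also have "\<dots> = Re (cinner x (weighted_sum M (\<lambda>i. (p i)\<^sup>2) *v x))
      * Re (cinner y (weighted_sum M (\<lambda>i. (q i)\<^sup>2) *v y))"
    by (simp add: power_mult_distrib L2_set_def Re_cinner_weighted_sum R_def sum_nonneg
        flip: norm_matrix_sqrt[OF M])
  finally show ?thesis .
qed

lemma pos_semidef_weighted_sum:
  assumes M: "\<And>i. pos_semidef (M i)" and p: "\<And>i. 0 \<le> p i"
  shows "pos_semidef (weighted_sum M p)"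
proof -
  have "cadjoint (weighted_sum M p) = weighted_sum M p"
  proof -
    have "cnj (M i $ k $ j) = M i $ j $ k" for i j k
      using M[of i] by (simp add: pos_semidef_iff hermitian_def cadjoint_def vec_eq_iff)
    then show ?thesis
      by (simp add: weighted_sum_def cadjoint_def vec_eq_iff matrix_scaleC_def map_matrix_def)
  qed
  then show ?thesis
    using M p by (auto simp: pos_semidef_iff hermitian_def Re_cinner_weighted_sum intro!: sum_nonneg)
qed

text \<open>The double sum of \<open>r i * r j * ((p i - p j) * (w i - w j))\<close> is nonnegative
  and equals twice the difference of the two sides.\<close>

lemma Chebyshev_weighted:
  fixes r p w :: "'i \<Rightarrow> real"
  assumes r: "\<And>i. 0 \<le> r i" and mono: "\<And>i j. 0 \<le> (p i - p j) * (w i - w j)"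
  shows "(\<Sum>i\<in>I. p i * r i) * (\<Sum>i\<in>I. w i * r i)
    \<le> (\<Sum>i\<in>I. r i) * (\<Sum>i\<in>I. p i * w i * r i)"
proof -
  have "0 \<le> (\<Sum>i\<in>I. \<Sum>j\<in>I. r i * r j * ((p i - p j) * (w i - w j)))"
    by (intro sum_nonneg mult_nonneg_nonneg[OF mult_nonneg_nonneg[OF r r] mono])
  also have "\<dots> = (\<Sum>i\<in>I. \<Sum>j\<in>I. (p i * w i * r i) * r j) - (\<Sum>i\<in>I. \<Sum>j\<in>I. (p i * r i) * (w j * r j))
     + ((\<Sum>i\<in>I. \<Sum>j\<in>I. r i * (p j * w j * r j)) - (\<Sum>i\<in>I. \<Sum>j\<in>I. (w i * r i) * (p j * r j)))"
    unfolding sum_subtractf[symmetric] sum.distrib[symmetric]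
    by (intro sum.cong refl) (simp add: algebra_simps)
  finally show ?thesis
    unfolding sum_product[symmetric] by (simp add: mult.commute)
qed

lemma weighted_sum_Chebyshev_Kadison:
  fixes M :: "'i::finite \<Rightarrow> complex^'d^'d" and a w :: "'i \<Rightarrow> real"
  assumes M: "\<And>i. pos_semidef (M i)" and one: "weighted_sum M (\<lambda>i. 1) = mat 1"
    and w: "\<And>i. 0 \<le> w i"
    and mono: "\<And>i j. 0 \<le> ((a i)\<^sup>2 - (a j)\<^sup>2) * (w i - w j)"
  defines "X \<equiv> weighted_sum M a"
  defines "W \<equiv> weighted_sum M w" and "Z \<equiv> weighted_sum M (\<lambda>i. (a i)\<^sup>2 * w i)"
  shows "(norm (X *v u))\<^sup>2 * Re (cinner (X *v u) (W *v (X *v u)))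
    \<le> (norm u)\<^sup>2 * Re (cinner (X *v u) (Z *v (X *v u)))"
proof -
  define v where "v = X *v u"
  define r where "r i = Re (cinner v (M i *v v))" for i
  have r: "0 \<le> r i" for i using M[of i] by (simp add: r_def pos_semidef_iff)
  have norm_v: "(norm v)\<^sup>2 = (\<Sum>i\<in>UNIV. r i)"
    using Re_cinner_weighted_sum[of v M "\<lambda>i. 1" v] by (simp add: one cinner_self r_def)
  \<comment> \<open>Kadison's inequality in weak form: Cauchy-Schwarz with second weight 1, where
    \<open>one\<close> turns the right factor into the squared norm of \<open>u\<close>.\<close>
  have "((norm v)\<^sup>2)\<^sup>2 = (cmod (cinner v (X *v u)))\<^sup>2"
    by (simp add: v_def[symmetric] cinner_self norm_power)
  also have "\<dots> \<le> (\<Sum>i\<in>UNIV. (a i)\<^sup>2 * r i) * (norm u)\<^sup>2"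
    using weighted_sum_Cauchy_Schwarz[of M v a "\<lambda>i. 1" u, OF M]
    by (simp add: one cinner_self X_def r_def Re_cinner_weighted_sum[of v])
  finally have 1: "((norm v)\<^sup>2)\<^sup>2 \<le> (\<Sum>i\<in>UNIV. (a i)\<^sup>2 * r i) * (norm u)\<^sup>2" .
  have W: "Re (cinner v (W *v v)) = (\<Sum>i\<in>UNIV. w i * r i)"
    and Z: "Re (cinner v (Z *v v)) = (\<Sum>i\<in>UNIV. (a i)\<^sup>2 * w i * r i)"
    by (simp_all add: W_def Z_def r_def Re_cinner_weighted_sum)
  have "(norm v)\<^sup>2 * ((norm v)\<^sup>2 * Re (cinner v (W *v v)))
      \<le> (norm u)\<^sup>2 * ((\<Sum>i\<in>UNIV. (a i)\<^sup>2 * r i) * (\<Sum>i\<in>UNIV. w i * r i))"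
    using mult_right_mono[OF 1, of "\<Sum>i\<in>UNIV. w i * r i"] w r
    by (simp add: W sum_nonneg power2_eq_square ac_simps)
  also have "\<dots> \<le> (norm u)\<^sup>2 * ((norm v)\<^sup>2 * Re (cinner v (Z *v v)))"
    unfolding norm_v Z using r mono by (intro mult_left_mono Chebyshev_weighted) auto
  finally have "(norm v)\<^sup>2 * ((norm v)\<^sup>2 * Re (cinner v (W *v v)))
      \<le> (norm v)\<^sup>2 * ((norm u)\<^sup>2 * Re (cinner v (Z *v v)))"
    by (simp add: ac_simps)
  \<comment> \<open>The common factor cancels unless \<open>v = 0\<close>, in which case both sides
    vanish.\<close>
  then show ?thesis
    unfolding v_def[symmetric] by (cases "v = 0") (simp_all only: mult_le_cancel_left_pos
        zero_less_power2 norm_eq_zero not_False_eq_True, simp)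
qed

theorem weighted_sum_product_factorization:
  fixes M :: "'i::finite \<Rightarrow> complex^'d^'d"
  assumes M: "\<And>i. pos_semidef (M i)" and one: "weighted_sum M (\<lambda>i. 1) = mat 1"
    and a: "\<And>i. 0 \<le> a i" and w: "\<And>i. 0 \<le> w i"
    and mono: "\<And>i j. 0 \<le> ((a i)\<^sup>2 - (a j)\<^sup>2) * (w i - w j)"
  defines "Z \<equiv> weighted_sum M (\<lambda>i. (a i)\<^sup>2 * w i)"
  shows "\<exists>K U. contraction K \<and> unitary U
    \<and> weighted_sum M (\<lambda>i. a i * w i) ** weighted_sum M a = matrix_sqrt Z ** K ** matrix_sqrt Z ** U"
proof -
  define X where "X = weighted_sum M a"
  define W where "W = weighted_sum M w"
  define Y where "Y = weighted_sum M (\<lambda>i. a i * w i)"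
  have Z: "pos_semidef Z" and X: "pos_semidef X" and W: "pos_semidef W"
    unfolding Z_def X_def W_def using a w by (auto intro!: pos_semidef_weighted_sum M)
  have Xa: "cadjoint X = X" using X by (simp add: pos_semidef_iff hermitian_def)
  define H where "H = X ** W ** X"
  have H_form: "cinner u (H *v u) = cinner (X *v u) (W *v (X *v u))" for u
    by (simp add: H_def cinner_adjoint[of u X] Xa flip: matrix_vector_mul_assoc)
  have H: "pos_semidef H"
    using W by (simp add: pos_semidef_iff H_form)
      (simp add: H_def hermitian_def cadjoint_mult Xa matrix_mul_assoc)
  have zero: "X *v u = 0 \<Longrightarrow> cinner u (H *v u) = 0" for u
    by (simp add: H_form)
  have le: "(norm (X *v u))\<^sup>2 * Re (cinner u (H *v u))
      \<le> (norm u)\<^sup>2 * Re (cinner (X *v u) (Z *v (X *v u)))" for u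
    unfolding H_form X_def W_def Z_def by (rule weighted_sum_Chebyshev_Kadison[OF M one w mono])
  obtain U where U: "unitary U"
    and dom: "\<And>y. Re (cinner y (H *v y)) \<le> Re (cinner (U *v y) (Z *v (U *v y)))"
    using unitary_domination[OF H Z zero le] by blast
  \<comment> \<open>Splitting the weight \<open>a i * w i\<close> as \<open>a i * sqrt (w i)\<close>
    times \<open>sqrt (w i)\<close> leaves \<open>Z\<close> on the left and \<open>W\<close> on the
    right.\<close>
  have YZW: "(cmod (cinner x (Y *v y)))\<^sup>2 \<le> Re (cinner x (Z *v x)) * Re (cinner y (W *v y))" for x y
    using weighted_sum_Cauchy_Schwarz[of M x "\<lambda>i. a i * sqrt (w i)" "\<lambda>i. sqrt (w i)" y, OF M] w
    by (simp add: Y_def Z_def W_def power_mult_distrib mult.assoc)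
  have "(cmod (cinner x ((Y ** X ** cadjoint U) *v y)))\<^sup>2
      \<le> Re (cinner x (Z *v x)) * Re (cinner y (Z *v y))" for x y
  proof -
    \<comment> \<open>Chosen so that \<open>dom\<close> at \<open>y'\<close> bounds the form of
      \<open>H\<close> by that of \<open>Z\<close> at \<open>y\<close> itself.\<close>
    define y' where "y' = cadjoint U *v y"
    have Uy': "U *v y' = y" using U by (simp add: y'_def matrix_vector_mul_assoc unitary_def)
    have "(cmod (cinner x ((Y ** X ** cadjoint U) *v y)))\<^sup>2
        \<le> Re (cinner x (Z *v x)) * Re (cinner y' (H *v y'))"
      using YZW[of x "X *v y'"] by (simp add: H_form) (simp add: y'_def matrix_vector_mul_assoc matrix_mul_assoc)
    also have "\<dots> \<le> Re (cinner x (Z *v x)) * Re (cinner y (Z *v y))"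
      using dom[of y'] Z by (intro mult_left_mono) (simp_all add: Uy' pos_semidef_iff)
    finally show ?thesis .
  qed
  from factor_through_matrix_sqrt[OF Z this] obtain K
    where K: "contraction K" "Y ** X ** cadjoint U = matrix_sqrt Z ** K ** matrix_sqrt Z"
    by blast
  have "Y ** X = Y ** X ** (cadjoint U ** U)" using U by (simp add: unitary_def)
  also have "\<dots> = matrix_sqrt Z ** K ** matrix_sqrt Z ** U" by (simp add: matrix_mul_assoc K(2))
  finally show ?thesis using K U unfolding X_def Y_def by blast
qed

section \<open>Concave functions and positive maps\<close>

text \<open>Concavity on the segment from 0 to \<open>t\<close>, with \<open>h 0\<close>
  nonnegative. It is the division-free form of the fact that \<open>h x / x\<close> decreases, and
  it makes the ratios \<open>w i\<close> increase with \<open>b i\<close>.\<close>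

lemma nonneg_concave_star_shaped:
  fixes h :: "real \<Rightarrow> real"
  assumes h: "\<And>x. 0 \<le> x \<Longrightarrow> 0 \<le> h x" "concave_on {0..} h" and "0 \<le> s" "s \<le> t"
  shows "s * h t \<le> t * h s"
proof (cases "t = 0")
  case False
  then have t: "0 < t" using assms by simp
  have "(1 - s / t) * h 0 + (s / t) * h t \<le> h ((1 - s / t) *\<^sub>R 0 + (s / t) *\<^sub>R t)"
    using assms t by (intro concave_onD[OF h(2)]) auto
  moreover have "0 \<le> (1 - s / t) * h 0"
    using assms t by (intro mult_nonneg_nonneg) auto
  ultimately have "s / t * h t \<le> h s" using t by simp
  then show ?thesis using t by (simp add: field_simps)
qed (use assms in simp)

text \<open>Beyond a drop from \<open>s\<close> to \<open>t\<close>, a concave function stays below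
  the extended chord and so eventually becomes negative.\<close>

lemma nonneg_concave_mono:
  fixes h :: "real \<Rightarrow> real"
  assumes h: "\<And>x. 0 \<le> x \<Longrightarrow> 0 \<le> h x" "concave_on {0..} h" and st: "0 \<le> s" "s \<le> t"
  shows "h s \<le> h t"
proof (rule ccontr)
  assume "\<not> h s \<le> h t"
  then have less: "h t < h s" by simp
  then have "s < t" using st by (cases "s = t") auto
  have ht: "0 \<le> h t" using h(1) st by simp
  \<comment> \<open>the abscissa at which the line through \<open>(s, h s)\<close> and \<open>(t, h t)\<close> reaches \<open>-1\<close>\<close>
  define T where "T = t + (t - s) * (h t + 1) / (h s - h t)"
  have T: "t < T" using less ht \<open>s < t\<close> by (simp add: T_def)
  define q where "q = (t - s) / (T - s)"
  have q: "0 \<le> q" "q \<le> 1" using T \<open>s < t\<close> by (auto simp: q_def)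
  have qT: "q * (T - s) = t - s" using T \<open>s < t\<close> by (simp add: q_def)
  have "(1 - q) * h s + q * h T \<le> h ((1 - q) *\<^sub>R s + q *\<^sub>R T)"
    using q st T by (intro concave_onD[OF h(2)]) auto
  moreover have "(1 - q) *\<^sub>R s + q *\<^sub>R T = t"
    using qT by (simp add: algebra_simps)
  moreover have "0 \<le> q * h T" using q h(1) T st by simp
  ultimately have "(1 - q) * h s \<le> h t" by simp
  then have "((T - s) * (1 - q)) * h s \<le> (T - s) * h t"
    using T \<open>s < t\<close> by (simp add: mult.assoc)
  moreover have "(T - s) * (1 - q) = T - t"
    using qT by (simp add: algebra_simps)
  ultimately have "(T - t) * h s \<le> (T - s) * h t" by simp
  then have "(T - t) * (h s - h t) \<le> (t - s) * h t" by (simp add: algebra_simps)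
  moreover have "(T - t) * (h s - h t) = (t - s) * (h t + 1)" using less by (simp add: T_def)
  ultimately show False using \<open>s < t\<close> by (simp add: algebra_simps)
qed

text \<open>For unitary \<open>V\<close> this is linearity applied to the decomposition into
  rank-one spectral projections.\<close>

lemma weighted_sum_positive_linear:
  assumes "positive_linear \<Phi>"
  shows "\<Phi> (V ** real_diag d ** cadjoint V)
    = weighted_sum (\<lambda>i. \<Phi> (V ** real_diag (axis i 1) ** cadjoint V)) (($) d)"
proof -
  interpret Vector_Spaces.linear matrix_scaleC matrix_scaleC \<Phi>
    using assms by (simp add: positive_linear_def complex_linear_def)
  have "V ** real_diag d ** cadjoint V
      = (\<Sum>k\<in>UNIV. matrix_scaleC (complex_of_real (d $ k)) (V ** real_diag (axis k 1) ** cadjoint V))"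
  proof -
    have "(V ** real_diag e ** cadjoint V) $ i $ j = (\<Sum>k\<in>UNIV. e $ k * (V $ i $ k * cnj (V $ j $ k)))"
      for e i j
      by (simp add: matrix_matrix_mult_def[of "V ** real_diag e"] real_diag_mult_right cadjoint_def
          ac_simps)
    then show ?thesis
      by (simp add: vec_eq_iff matrix_scaleC_def map_matrix_def axis_def if_distrib if_distribR
          cong: if_cong)
  qed
  then show ?thesis by (simp add: weighted_sum_def sum scale)
qed

lemma real_diag_one: "real_diag (\<chi> i. 1) = mat 1"
  by (simp add: real_diag_def mat_def vec_eq_iff)

theorem theorem2p3:
  fixes A B :: "complex^'n^'n" and \<Phi> :: "complex^'n^'n \<Rightarrow> complex^'d^'d"
  assumes "concave_monotone_pair A B"
    and "positive_linear \<Phi>" and "unital \<Phi>"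
  shows "\<exists>K U :: complex^'d^'d. contraction K \<and> unitary U
    \<and> \<Phi> B ** \<Phi> A = matrix_sqrt (\<Phi> (A ** B)) ** K ** matrix_sqrt (\<Phi> (A ** B)) ** U"
proof -
  obtain C g h where C: "pos_semidef C" and g_im: "g ` {0..} \<subseteq> {0..}" and B: "B = matrix_fun g C"
    and h_im: "h ` {0..} \<subseteq> {0..}" and concave: "concave_on {0..} h" and A: "A = matrix_fun h B"
    using assms(1) unfolding concave_monotone_pair_def monotone_pair_def by blast
  have g: "0 \<le> x \<Longrightarrow> 0 \<le> g x" and h: "0 \<le> x \<Longrightarrow> 0 \<le> h x" for x
    using g_im h_im by (simp_all add: image_subset_iff)
  \<comment> \<open>The eigenbasis of \<open>C\<close> also diagonalizes \<open>B = g(C)\<close>,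
    and hence \<open>A = h(B)\<close>.\<close>
  obtain V c where V: "unitary V" and c: "\<And>i. 0 \<le> c $ i" and Ceq: "C = V ** real_diag c ** cadjoint V"
    using pos_semidef_diagonalize[OF C] by metis
  define D where "D p = V ** real_diag (\<chi> i. p i) ** cadjoint V" for p
  define b where "b i = g (c $ i)" for i
  define a where "a i = h (b i)" for i
  \<comment> \<open>Division by zero yields \<open>w i = 0\<close> where \<open>a i = 0\<close>, the
    least possible value, so monotonicity survives there.\<close>
  define w where "w i = b i / a i" for i
  define M where "M i = \<Phi> (V ** real_diag (axis i 1) ** cadjoint V)" for i
  have b: "0 \<le> b i" for i using g c[of i] by (simp add: b_def)
  have a: "0 \<le> a i" for i using h b[of i] by (simp add: a_def)
  have w: "0 \<le> w i" for i using a b by (simp add: w_def)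
  have B_diag: "B = D b" unfolding B Ceq D_def b_def by (rule matrix_fun_diag[OF V])
  have A_diag: "A = D a" unfolding A B_diag D_def a_def by (simp add: matrix_fun_diag[OF V])
  have AB: "A ** B = D (\<lambda>i. a i * b i)"
    unfolding A_diag B_diag D_def by (simp add: real_diag_conj_mult[OF V])
  have \<Phi>_D: "\<Phi> (D p) = weighted_sum M p" for p
    using weighted_sum_positive_linear[OF assms(2), of V "\<chi> i. p i"]
    by (simp add: D_def M_def weighted_sum_def)
  have one: "weighted_sum M (\<lambda>i. 1) = mat 1"
    using V assms(3) by (simp add: D_def real_diag_one unitary_def unital_def flip: \<Phi>_D)
  have M: "pos_semidef (M i)" for i
    using assms(2) V unfolding M_def positive_linear_def
    by (simp add: pos_semidef_real_diag_conj axis_def)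
  have order: "(a i)\<^sup>2 \<le> (a j)\<^sup>2 \<and> w i \<le> w j" if "b i \<le> b j" for i j
  proof
    have "a i \<le> a j" unfolding a_def by (rule nonneg_concave_mono[OF h concave b that])
    then show "(a i)\<^sup>2 \<le> (a j)\<^sup>2" using a by (simp add: power_mono)
    have star: "b i * a j \<le> b j * a i"
      unfolding a_def by (rule nonneg_concave_star_shaped[OF h concave b that])
    show "w i \<le> w j"
    proof (cases "a i = 0")
      case True
      then show ?thesis using w[of j] by (simp add: w_def)
    next
      case False
      then have "0 < a i" "0 < a j" using a[of i] \<open>a i \<le> a j\<close> by auto
      then show ?thesis using star by (simp add: w_def field_simps)
    qed
  qed
  have mono: "0 \<le> ((a i)\<^sup>2 - (a j)\<^sup>2) * (w i - w j)" for i j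
    using order[of i j] order[of j i] by (cases "b i \<le> b j") (auto simp: zero_le_mult_iff)
  show ?thesis
  \<comment> \<open>The identity \<open>b i = a i * w i\<close> fails exactly when
    \<open>a i = 0\<close> and \<open>b i\<close> is positive; in that case \<open>A\<close> turns
    out to be zero.\<close>
  proof (cases "\<forall>i. a i = 0 \<longrightarrow> b i = 0")
    case True
    then have b_eq: "b = (\<lambda>i. a i * w i)" and ab_eq: "(\<lambda>i. a i * b i) = (\<lambda>i. (a i)\<^sup>2 * w i)"
      by (auto simp: w_def fun_eq_iff power2_eq_square)
    have "\<Phi> B = weighted_sum M (\<lambda>i. a i * w i)"
      unfolding B_diag \<Phi>_D by (rule arg_cong[OF b_eq])
    moreover have "\<Phi> (A ** B) = weighted_sum M (\<lambda>i. (a i)\<^sup>2 * w i)"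
      by (simp only: AB ab_eq \<Phi>_D)
    moreover have "\<Phi> A = weighted_sum M a"
      by (simp only: A_diag \<Phi>_D)
    ultimately show ?thesis
      using weighted_sum_product_factorization[of M a w, OF M one a w mono] by simp
  next
    case False
    \<comment> \<open>A concave \<open>h \<ge> 0\<close> that vanishes at a positive point is zero on $[0,\infty)$.\<close>
    then obtain k where k: "a k = 0" "0 < b k" using b by (metis less_eq_real_def)
    have "a i = 0" for i
    proof (cases "b i \<le> b k")
      case True
      then show ?thesis using nonneg_concave_mono[OF h concave b True] k a[of i] by (simp add: a_def)
    next
      case False
      then have le: "b k \<le> b i" by linarith
      have "b k * a i \<le> b i * a k"
        unfolding a_def by (rule nonneg_concave_star_shaped[OF h concave b le])
      then show ?thesis using k a[of i] by (simp add: mult_le_0_iff)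
    qed
    then have "\<Phi> A = 0"
      unfolding A_diag \<Phi>_D
      by (simp add: weighted_sum_def matrix_scaleC_def map_matrix_def vec_eq_iff)
    moreover have "contraction (0 :: complex^'d^'d)"
      by (simp add: contraction_def onorm_zero)
    moreover have "unitary (mat 1 :: complex^'d^'d)"
      using cadjoint_real_diag[of "\<chi> i. 1"] by (simp add: unitary_def real_diag_one)
    ultimately show ?thesis
      by (intro exI[of _ 0] exI[of _ "mat 1"]) simp
  qed
qed

end
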